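(* If $G$ is a nice graph, then $\mathrm{ch}_\Pi^*(G) \leq 2\,\mathrm{ch}_\Sigma(G)-1$.
   Context: Graphs are finite and simple. A graph is nice if it has no connected component isomorphic to $K_2$. A $k$-list assignment $L$ of $G$ assigns to every edge $e \in E(G)$ a set $L(e)$ of $k$ real numbers. An $L$-labelling is a map $\ell$ on $E(G)$ with $\ell(e) \in L(e)$ for every edge $e$. For a vertex $v$, set $\sigma_\ell(v)=\sum_{w \in N(v)} \ell(vw)$ and $\pi_\ell(v)=\prod_{w \in N(v)} \ell(vw)$. The labelling $\ell$ is s-proper if $\sigma_\ell(u) \neq \sigma_\ell(v)$ for every edge $uv$, and p-proper if $\pi_\ell(u) \neq \pi_\ell(v)$ for every edge $uv$. $\mathrm{ch}_\Sigma(G)$ is the smallest $k \geq 1$ such that $G$ admits an s-proper $L$-labelling for every $k$-list assignment $L$. $\mathrm{ch}_\Pi^*(G)$ is the smallest $k \geq 1$, if any, such that $G$ admits a p-proper $L$-labelling for every $k$-list assignment $L$ with $0 \notin L(e)$ for every edge $e$. *)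

theory Defs
  imports Complex_Main "HOL-Library.Extended_Nat" "Graph_Theory.Graph_Theory"
begin

(* Finite simple graphs are those of the locale graph of Graph_Theory: finite, loop-free
   symmetric digraphs without parallel arcs.  The undirected edge uv is the pair of opposite
   arcs from u to v and from v to u; labels and lists are indexed by the two-element set
   {u, v}, so both arcs carry the same label. *)

definition edges :: "('a, 'b) pre_digraph \<Rightarrow> 'a set set" where
  "edges G = {{u, v} | u v. u \<rightarrow>\<^bsub>G\<^esub> v}"

definition nbhd :: "('a, 'b) pre_digraph \<Rightarrow> 'a \<Rightarrow> 'a set" where
  "nbhd G v = {w. v \<rightarrow>\<^bsub>G\<^esub> w}"

(* In a symmetric digraph, the strongly connected components are the connected components. *)
definition nice :: "('a, 'b) pre_digraph \<Rightarrow> bool" where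
  "nice G \<longleftrightarrow> (\<forall>H \<in> pre_digraph.sccs G. \<not> complete_digraph 2 H)"

definition list_assignment :: "('a, 'b) pre_digraph \<Rightarrow> nat \<Rightarrow> ('a set \<Rightarrow> real set) \<Rightarrow> bool" where
  "list_assignment G k L \<longleftrightarrow> (\<forall>e \<in> edges G. finite (L e) \<and> card (L e) = k)"

definition labelling ::
  "('a, 'b) pre_digraph \<Rightarrow> ('a set \<Rightarrow> real set) \<Rightarrow> ('a set \<Rightarrow> real) \<Rightarrow> bool" where
  "labelling G L l \<longleftrightarrow> (\<forall>e \<in> edges G. l e \<in> L e)"

definition vsum :: "('a, 'b) pre_digraph \<Rightarrow> ('a set \<Rightarrow> real) \<Rightarrow> 'a \<Rightarrow> real" where
  "vsum G l v = (\<Sum>w \<in> nbhd G v. l {v, w})"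

definition vprod :: "('a, 'b) pre_digraph \<Rightarrow> ('a set \<Rightarrow> real) \<Rightarrow> 'a \<Rightarrow> real" where
  "vprod G l v = (\<Prod>w \<in> nbhd G v. l {v, w})"

definition s_proper :: "('a, 'b) pre_digraph \<Rightarrow> ('a set \<Rightarrow> real) \<Rightarrow> bool" where
  "s_proper G l \<longleftrightarrow> (\<forall>u v. u \<rightarrow>\<^bsub>G\<^esub> v \<longrightarrow> vsum G l u \<noteq> vsum G l v)"

definition p_proper :: "('a, 'b) pre_digraph \<Rightarrow> ('a set \<Rightarrow> real) \<Rightarrow> bool" where
  "p_proper G l \<longleftrightarrow> (\<forall>u v. u \<rightarrow>\<^bsub>G\<^esub> v \<longrightarrow> vprod G l u \<noteq> vprod G l v)"

(* Both parameters are minima over sets of positive integers, taken in the extended naturals: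
   the value is infinity exactly if there is no admissible k. *)

definition ch_sum :: "('a, 'b) pre_digraph \<Rightarrow> enat" where
  "ch_sum G = Inf {enat k | k. 1 \<le> k \<and>
     (\<forall>L. list_assignment G k L \<longrightarrow> (\<exists>l. labelling G L l \<and> s_proper G l))}"

definition ch_prod_star :: "('a, 'b) pre_digraph \<Rightarrow> enat" where
  "ch_prod_star G = Inf {enat k | k. 1 \<le> k \<and>
     (\<forall>L. list_assignment G k L \<and> (\<forall>e \<in> edges G. 0 \<notin> L e) \<longrightarrow>
          (\<exists>l. labelling G L l \<and> p_proper G l))}"

end

theory Submission
  imports Defs
begin

text \<open>
  A nonzero value is determined by its sign and the logarithm of its absolute value, so a list of
  \<open>2k - 1\<close> nonzero reals yields at least \<open>k\<close> distinct logarithms. The map \<open>ln \<bar>\<cdot>\<bar>\<close> turns products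
  into sums, so an s-proper labelling from lists of logarithms pulls back to a labelling whose
  vertex products differ already in absolute value along every edge.
\<close>

text \<open>Over a logarithm \<open>y\<close> lie at most the two nonzero reals \<open>exp y\<close>
  and \<open>- exp y\<close>, so two copies of the image cover \<open>A\<close>.\<close>

lemma card_le_twice_card_ln_abs_image:
  fixes A :: "real set"
  assumes "finite A" "0 \<notin> A"
  shows "card A \<le> 2 * card ((\<lambda>x. ln \<bar>x\<bar>) ` A)"
proof -
  define B where "B = (\<lambda>x. ln \<bar>x\<bar>) ` A"
  have fin: "finite B"
    using assms by (simp add: B_def)
  have "A \<subseteq> exp ` B \<union> (\<lambda>y. - exp y) ` B"
  proof
    fix x assume x: "x \<in> A"
    with assms have "exp (ln \<bar>x\<bar>) = \<bar>x\<bar>" by auto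
    then have "x = exp (ln \<bar>x\<bar>) \<or> x = - exp (ln \<bar>x\<bar>)" by linarith
    moreover have "ln \<bar>x\<bar> \<in> B" using x by (simp add: B_def)
    ultimately show "x \<in> exp ` B \<union> (\<lambda>y. - exp y) ` B" by blast
  qed
  then have "card A \<le> card (exp ` B \<union> (\<lambda>y. - exp y) ` B)"
    using fin by (intro card_mono) auto
  also have "\<dots> \<le> card (exp ` B) + card ((\<lambda>y. - exp y) ` B)"
    by (rule card_Un_le)
  also have "\<dots> \<le> card B + card B"
    using fin by (intro add_mono card_image_le)
  finally show ?thesis by (simp add: B_def)
qed

lemma ln_abs_prod:
  fixes f :: "'i \<Rightarrow> real"
  assumes "finite I" "\<And>i. i \<in> I \<Longrightarrow> f i \<noteq> 0"
  shows "ln \<bar>\<Prod>i\<in>I. f i\<bar> = (\<Sum>i\<in>I. ln \<bar>f i\<bar>)"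
  using assms by (simp add: abs_prod ln_prod)

lemma edgesI: "v \<rightarrow>\<^bsub>G\<^esub> w \<Longrightarrow> {v, w} \<in> edges G"
  unfolding edges_def by blast

lemma (in fin_digraph) finite_nbhd: "finite (nbhd G v)"
  by (rule finite_subset[OF _ finite_verts]) (auto simp: nbhd_def)

text \<open>Transfers labels to logarithms at a single vertex. At an isolated vertex it reads
  \<open>0 = ln 1\<close>.\<close>

lemma (in fin_digraph) vsum_eq_ln_abs_vprod:
  assumes "\<And>e. e \<in> edges G \<Longrightarrow> l e \<noteq> 0"
    and "\<And>e. e \<in> edges G \<Longrightarrow> l' e = ln \<bar>l e\<bar>"
  shows "vsum G l' v = ln \<bar>vprod G l v\<bar>"
proof -
  have edge: "{v, w} \<in> edges G" if "w \<in> nbhd G v" for w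
    using that by (auto simp: nbhd_def intro: edgesI)
  have "ln \<bar>vprod G l v\<bar> = (\<Sum>w\<in>nbhd G v. ln \<bar>l {v, w}\<bar>)"
    unfolding vprod_def by (intro ln_abs_prod finite_nbhd assms(1) edge)
  also have "\<dots> = vsum G l' v"
    unfolding vsum_def by (intro sum.cong refl assms(2)[symmetric] edge)
  finally show ?thesis ..
qed

lemma (in fin_digraph) p_proper_labelling_exists:
  assumes "1 \<le> k"
    and sum: "\<And>L. list_assignment G k L \<Longrightarrow> \<exists>l. labelling G L l \<and> s_proper G l"
    and L: "list_assignment G (2 * k - 1) L" "\<And>e. e \<in> edges G \<Longrightarrow> 0 \<notin> L e"
  shows "\<exists>l. labelling G L l \<and> p_proper G l"
proof -
  have "\<exists>B \<subseteq> (\<lambda>x. ln \<bar>x\<bar>) ` L e. finite B \<and> card B = k" if e: "e \<in> edges G" for e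
  proof -
    have "finite (L e)" "card (L e) = 2 * k - 1"
      using L(1) e by (auto simp: list_assignment_def)
    \<comment> \<open>If \<open>m\<close> logarithms occur, then
      \<open>2 * k - 1 \<le> 2 * m\<close>; the left side is odd, hence \<open>k \<le> m\<close>.
      This is the source of the bound \<open>2 * k - 1\<close>.\<close>
    with card_le_twice_card_ln_abs_image[OF _ L(2)[OF e]] \<open>1 \<le> k\<close>
    have "k \<le> card ((\<lambda>x. ln \<bar>x\<bar>) ` L e)" by fastforce
    \<comment> \<open>List assignments have lists of size exactly \<open>k\<close>, so surplus
      logarithms are discarded.\<close>
    then show ?thesis
      by (metis obtain_subset_with_card_n)
  qed
  then obtain L' where L': "L' e \<subseteq> (\<lambda>x. ln \<bar>x\<bar>) ` L e" "finite (L' e)" "card (L' e) = k"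
    if "e \<in> edges G" for e
    by metis
  then have "list_assignment G k L'"
    by (simp add: list_assignment_def)
  then obtain l' where l': "labelling G L' l'" "s_proper G l'"
    using sum by blast
  \<comment> \<open>Pull back each chosen logarithm to a list element; either sign will do.\<close>
  have "\<exists>x \<in> L e. l' e = ln \<bar>x\<bar>" if "e \<in> edges G" for e
    using L'(1)[OF that] l'(1) that by (auto simp: labelling_def)
  then obtain l where l: "l e \<in> L e" "l' e = ln \<bar>l e\<bar>" if "e \<in> edges G" for e
    by metis
  have "vsum G l' v = ln \<bar>vprod G l v\<bar>" for v
    using l L(2) by (intro vsum_eq_ln_abs_vprod) metis+
  \<comment> \<open>Equal products at adjacent vertices would have equal
    \<open>ln \<bar>\<cdot>\<bar>\<close>, hence equal sums under \<open>l'\<close>.\<close>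
  with l'(2) have "p_proper G l"
    unfolding s_proper_def p_proper_def by metis
  with l(1) show ?thesis
    by (auto simp: labelling_def)
qed

theorem theorem2p5:
  fixes G :: "('a, 'b) pre_digraph"
  assumes "graph G"
    and "nice G"
  shows "ch_prod_star G \<le> 2 * ch_sum G - 1"
proof -
  interpret graph G by fact
  let ?S = "{enat k | k. 1 \<le> k \<and>
    (\<forall>L. list_assignment G k L \<longrightarrow> (\<exists>l. labelling G L l \<and> s_proper G l))}"
  show ?thesis
  proof (cases "?S = {}")
    case True
    \<comment> \<open>The infimum of the empty set is \<open>\<infinity>\<close>, and then so is the
      right-hand side of the bound.\<close>
    then have "ch_sum G = \<infinity>"
      unfolding ch_sum_def by (simp only: Inf_enat_def simp_thms if_True)
    then show ?thesis by (simp add: one_enat_def numeral_eq_enat)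
  next
    case False
    \<comment> \<open>\<open>enat\<close> is well-ordered, so the infimum of a nonempty set is
      attained.\<close>
    then have "ch_sum G \<in> ?S"
      unfolding ch_sum_def by (meson ex_in_conv wellorder_InfI)
    then obtain k where k: "ch_sum G = enat k" "1 \<le> k"
      and sum: "\<And>L. list_assignment G k L \<Longrightarrow> \<exists>l. labelling G L l \<and> s_proper G l"
      by blast
    have "ch_prod_star G \<le> enat (2 * k - 1)"
      unfolding ch_prod_star_def
      using p_proper_labelling_exists[OF k(2) sum] k(2) by (intro Inf_lower) auto
    then show ?thesis
      by (simp add: k(1) one_enat_def numeral_eq_enat)
  qed
qed

end
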